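(* Let $T$ be a finite tree with $k=\mathrm{pw}(T)$, $s\in V(T)$ a prediction, $t\in V(T)$ the hidden target, and $D=\mathrm{dist}_T(s,t)$. Then the $k$-Spine Exponential Search algorithm (described in the context), run with any fixed $k$-spine decomposition of $T$, makes $O(k\log D)$ oracle queries.
   Context: Direction oracle for target $t$: querying $v\in V(T)$ returns "here" if $v=t$, and otherwise the unique neighbor of $v$ on the path in $T$ from $v$ to $t$. $\mathrm{dist}_T(u,v)$ is the number of edges on the $u$–$v$ path in $T$. Pathwidth $\mathrm{pw}$ is the usual graph pathwidth (minimum over path decompositions $B_1,\dots,B_m$ — vertex sets covering all vertices, every edge inside some bag, each vertex's bags forming an interval — of $\max|B_i|-1$); a tree has pathwidth $0$ iff it is a single vertex. For a tree $T$ with $\mathrm{pw}(T)=k\ge1$, a $k$-spine of $T$ is a path $P$ in $T$ such that every connected component of $T\setminus V(P)$ has pathwidth at most $k-1$. A $k$-spine decomposition is obtained recursively: remove a $k$-spine of $T$, then recursively remove a $\mathrm{pw}(C)$-spine from each connected component $C$ of what remains, stopping at singleton components; thus each component arising in the recursion has a designated spine. $k$-Spine Exponential Search: maintain a current component $T_{cur}$ (initially $T$) and start vertex $s_{cur}$ (initially $s$). While $T_{cur}$ is not a single vertex: let $P$ be the designated spine of $T_{cur}$; let $a$ be the vertex of $P$ closest to $s_{cur}$; run exponential (doubling binary) search on the path $P$ starting from $a$, using oracle answers as directions along $P$, until either "here" is returned (then return that vertex) or the oracle at some $x\in P$ returns a neighbor $y\notin P$; in the latter case set $T_{cur}$ to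 the component of $T_{cur}\setminus V(P)$ containing $y$ and $s_{cur}:=y$. When $T_{cur}$ is a single vertex, return it. Exponential search on a path from $a$ finds an unknown vertex $x$ of the path using $O(\log(\mathrm{dist}_P(a,x)+1))$ queries.
   Formalization: On descending to a new component, the start vertex stays s_cur if s_cur lies in it and becomes y only otherwise (always resetting to y makes the bound false, e.g. on a spider with three long legs); log D is read as max(1, log₂ D), since log D is 0 or undefined for D ≤ 1. *)

theory Defs
  imports Complex_Main "Graph_Theory.Graph_Theory"
begin

section \<open>Trees\<close>

text \<open>
  Undirected simple finite graphs are symmetric digraphs (locale \<^term>\<open>graph\<close>).  The library
  predicate \<^const>\<open>tree\<close> is unsuitable for them: in a symmetric digraph every edge traversed
  back and forth is a \<^const>\<open>pre_digraph.cycle\<close> of length 2.  A cycle of the undirected graph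
  is one of length at least 3.
\<close>

definition undirected_tree :: "('a, 'b) pre_digraph \<Rightarrow> bool" where
  "undirected_tree T \<longleftrightarrow>
     graph T \<and> Digraph_Component.connected T \<and>
     \<not> (\<exists>c. pre_digraph.cycle T c \<and> 3 \<le> length c)"

definition tree_path :: "('a, 'b) pre_digraph \<Rightarrow> 'a \<Rightarrow> 'a \<Rightarrow> 'a list" where
  "tree_path T u v = (THE p. vpath p T \<and> hd p = u \<and> last p = v)"

definition tree_dist :: "('a, 'b) pre_digraph \<Rightarrow> 'a \<Rightarrow> 'a \<Rightarrow> nat" where
  "tree_dist T u v = vwalk_length (tree_path T u v)"

text \<open>In a symmetric digraph the strongly connected components are the connected components.\<close>

abbreviation components :: "('a, 'b) pre_digraph \<Rightarrow> 'a set set" where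
  "components G \<equiv> pre_digraph.sccs_verts G"

abbreviation component_of :: "('a, 'b) pre_digraph \<Rightarrow> 'a \<Rightarrow> 'a set" where
  "component_of G v \<equiv> pre_digraph.scc_of G v"


section \<open>Pathwidth\<close>

definition path_decomposition :: "('a, 'b) pre_digraph \<Rightarrow> 'a set list \<Rightarrow> bool" where
  "path_decomposition G Bs \<longleftrightarrow>
     Bs \<noteq> [] \<and>
     \<Union> (set Bs) = verts G \<and>
     (\<forall>(u, v) \<in> arcs_ends G. \<exists>B \<in> set Bs. u \<in> B \<and> v \<in> B) \<and>
     (\<forall>i j l. i \<le> j \<and> j \<le> l \<and> l < length Bs \<longrightarrow> Bs ! i \<inter> Bs ! l \<subseteq> Bs ! j)"

definition decomposition_width :: "'a set list \<Rightarrow> nat" where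
  "decomposition_width Bs = Max (card ` set Bs) - 1"

definition pathwidth :: "('a, 'b) pre_digraph \<Rightarrow> nat" where
  "pathwidth G = (LEAST w. \<exists>Bs. path_decomposition G Bs \<and> decomposition_width Bs = w)"


section \<open>Spine decompositions\<close>

definition is_spine :: "('a, 'b) pre_digraph \<Rightarrow> nat \<Rightarrow> 'a list \<Rightarrow> bool" where
  "is_spine G k p \<longleftrightarrow>
     vpath p G \<and>
     (\<forall>C \<in> components (G \<restriction> (verts G - set p)). pathwidth (G \<restriction> C) \<le> k - 1)"

text \<open>
  A decomposition is given by the map \<open>\<sigma>\<close> from the (vertex sets of the) components arising in the
  recursion to their designated spines.  Its values on other sets are irrelevant.
\<close>

inductive_set arising_components ::
  "('a, 'b) pre_digraph \<Rightarrow> ('a set \<Rightarrow> 'a list) \<Rightarrow> 'a set set"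
  for T :: "('a, 'b) pre_digraph" and \<sigma> :: "'a set \<Rightarrow> 'a list"
where
  whole: "verts T \<in> arising_components T \<sigma>"
| part: "\<lbrakk>C \<in> arising_components T \<sigma>; \<not> is_singleton C;
    C' \<in> components (T \<restriction> (C - set (\<sigma> C)))\<rbrakk> \<Longrightarrow> C' \<in> arising_components T \<sigma>"

definition spine_decomposition :: "('a, 'b) pre_digraph \<Rightarrow> ('a set \<Rightarrow> 'a list) \<Rightarrow> bool" where
  "spine_decomposition T \<sigma> \<longleftrightarrow>
     (\<forall>C \<in> arising_components T \<sigma>. \<not> is_singleton C \<longrightarrow>
        is_spine (T \<restriction> C) (pathwidth (T \<restriction> C)) (\<sigma> C))"


section \<open>The direction oracle\<close>

datatype 'a answer = Here | Toward 'a

definition direction_oracle :: "('a, 'b) pre_digraph \<Rightarrow> 'a \<Rightarrow> 'a \<Rightarrow> 'a answer" where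
  "direction_oracle T t v = (if v = t then Here else Toward (tree_path T v t ! 1))"


section \<open>Exponential search on a path\<close>

text \<open>
  Positions on the path \<open>p\<close> are list indices.  \<open>Stop\<close> means that the oracle answered \<open>Here\<close> or
  pointed off the path.  All search procedures return the stopping position (or vertex) together
  with the number of oracle queries made; each evaluation of \<open>mv\<close> is one query.  The result
  \<^const>\<open>None\<close> stands for nontermination.
\<close>

datatype move = Backward | Stop | Forward

definition path_move :: "('a \<Rightarrow> 'a answer) \<Rightarrow> 'a list \<Rightarrow> nat \<Rightarrow> move" where
  "path_move ask p i =
     (case ask (p ! i) of
        Here \<Rightarrow> Stop
      | Toward y \<Rightarrow>
          if i + 1 < length p \<and> y = p ! (i + 1) then Forward
          else if 0 < i \<and> y = p ! (i - 1) then Backward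
          else Stop)"

text \<open>Here \<open>mv\<close> is known to answer \<open>Forward\<close> at \<open>lo\<close> and \<open>Backward\<close> at \<open>hi\<close>.\<close>

partial_function (option) binary_search ::
  "(nat \<Rightarrow> move) \<Rightarrow> nat \<Rightarrow> nat \<Rightarrow> nat \<Rightarrow> (nat \<times> nat) option"
where
  "binary_search mv lo hi q =
     (let m = (lo + hi) div 2 in
      case mv m of
        Stop \<Rightarrow> Some (m, q + 1)
      | Forward \<Rightarrow> binary_search mv m hi (q + 1)
      | Backward \<Rightarrow> binary_search mv lo m (q + 1))"

text \<open>
  Probes the positions \<open>a + 1, a + 2, a + 4, \<dots>\<close>, truncated at the end of a path with \<open>n\<close> vertices;
  \<open>lo\<close> is the last position where \<open>mv\<close> is known to answer \<open>Forward\<close>.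
\<close>

partial_function (option) doubling_search ::
  "(nat \<Rightarrow> move) \<Rightarrow> nat \<Rightarrow> nat \<Rightarrow> nat \<Rightarrow> nat \<Rightarrow> nat \<Rightarrow> (nat \<times> nat) option"
where
  "doubling_search mv n a d lo q =
     (let m = min (a + d) (n - 1) in
      case mv m of
        Stop \<Rightarrow> Some (m, q + 1)
      | Forward \<Rightarrow> doubling_search mv n a (2 * d) m (q + 1)
      | Backward \<Rightarrow> binary_search mv lo m (q + 1))"

definition forward_search :: "('a \<Rightarrow> 'a answer) \<Rightarrow> 'a list \<Rightarrow> nat \<Rightarrow> nat \<Rightarrow> ('a \<times> nat) option" where
  "forward_search ask p a q =
     map_option (\<lambda>(i, q'). (p ! i, q')) (doubling_search (path_move ask p) (length p) a 1 a q)"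

definition exponential_search :: "('a \<Rightarrow> 'a answer) \<Rightarrow> 'a list \<Rightarrow> nat \<Rightarrow> ('a \<times> nat) option" where
  "exponential_search ask p a =
     (case path_move ask p a of
        Stop \<Rightarrow> Some (p ! a, 1)
      | Forward \<Rightarrow> forward_search ask p a 1
      | Backward \<Rightarrow> forward_search ask (rev p) (length p - 1 - a) 1)"


section \<open>Spine exponential search\<close>

definition closest_position :: "('a, 'b) pre_digraph \<Rightarrow> 'a list \<Rightarrow> 'a \<Rightarrow> nat" where
  "closest_position T p s = arg_min_on (\<lambda>i. tree_dist T s (p ! i)) {..<length p}"

text \<open>
  \<open>C\<close> and \<open>s\<close> are the current component and start vertex, \<open>q\<close> the number of queries made so far.
  The inspection of \<open>ask x\<close> reuses the answer on which the exponential search stopped, hence is not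
  counted again.

  When the search moves on to the component \<open>C'\<close> of \<open>y\<close>, the new start vertex is the vertex of
  \<open>C'\<close> closest to \<open>s\<close>: this is \<open>y\<close> if \<open>s\<close> lies outside \<open>C'\<close>, and \<open>s\<close> itself otherwise.
  Resetting it to \<open>y\<close> also when \<open>s \<in> C'\<close> would lose the prediction: on a spider with three legs
  of length \<open>n\<close> whose designated spine is the centre alone, with \<open>s\<close> and \<open>t\<close> at distance 2 near the
  end of one leg, the search would restart at the beginning of that leg and need about
  \<open>log n\<close> queries.
\<close>

partial_function (option) spine_search_from ::
  "('a, 'b) pre_digraph \<Rightarrow> ('a \<Rightarrow> 'a answer) \<Rightarrow> ('a set \<Rightarrow> 'a list) \<Rightarrow>
   'a set \<Rightarrow> 'a \<Rightarrow> nat \<Rightarrow> ('a \<times> nat) option"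
where
  "spine_search_from T ask \<sigma> C s q =
     (if is_singleton C then Some (the_elem C, q)
      else Option.bind (exponential_search ask (\<sigma> C) (closest_position T (\<sigma> C) s))
        (\<lambda>(x, q').
           case ask x of
             Here \<Rightarrow> Some (x, q + q')
           | Toward y \<Rightarrow>
               (let C' = component_of (T \<restriction> (C - set (\<sigma> C))) y in
                spine_search_from T ask \<sigma> C' (if s \<in> C' then s else y) (q + q'))))"

definition spine_exponential_search ::
  "('a, 'b) pre_digraph \<Rightarrow> ('a set \<Rightarrow> 'a list) \<Rightarrow> 'a \<Rightarrow> 'a \<Rightarrow> ('a \<times> nat) option"
where
  "spine_exponential_search T \<sigma> s t =
     spine_search_from T (direction_oracle T t) \<sigma> (verts T) s 0"

end

theory Submission
  imports Defs "HOL-Library.Log_Nat"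
begin

text \<open>
  Paths in a tree are unique, so every vertex reaches a path \<open>P\<close> at a well-defined vertex.  Let \<open>a\<close>
  and \<open>x\<close> be these entry points for the current start vertex \<open>s\<close> and the target \<open>t\<close>.  Then \<open>a\<close> is
  the vertex of \<open>P\<close> closest to \<open>s\<close>, the oracle answers on \<open>P\<close> point to \<open>x\<close>, and if \<open>a \<noteq> x\<close> the path
  from \<open>s\<close> to \<open>t\<close> runs along \<open>P\<close> from \<open>a\<close> to \<open>x\<close>; so one exponential search from \<open>a\<close> costs
  logarithmically many queries in the distance of \<open>s\<close> and \<open>t\<close>.  If \<open>s\<close> is not in the component of
  \<open>t\<close> off the spine, then the path from \<open>s\<close> to \<open>t\<close> enters that component at the new start
  vertex \<open>y\<close>, so the distance to \<open>t\<close> never grows.  The pathwidth drops in every round, and a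
  connected graph of pathwidth 0 is a single vertex, which bounds the number of rounds.
\<close>

section \<open>Searching a path\<close>

definition points_to :: "(nat \<Rightarrow> move) \<Rightarrow> nat \<Rightarrow> nat \<Rightarrow> bool" where
  "points_to mv n x \<longleftrightarrow> x < n \<and>
     (\<forall>i<n. mv i = (if i < x then Forward else if i = x then Stop else Backward))"

lemma points_to_case:
  assumes "points_to mv n x" "i < n"
  shows "(case mv i of Backward \<Rightarrow> b | Stop \<Rightarrow> h | Forward \<Rightarrow> f) =
    (if i < x then f else if i = x then h else b)"
  using assms by (simp add: points_to_def)

lemma binary_search_queries:
  assumes "points_to mv n x" "lo < x" "x < hi" "hi < n" "hi - lo \<le> 2 ^ j"
  shows "\<exists>q'\<le>j. binary_search mv lo hi q = Some (x, q + q')"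
  using assms(2-)
proof (induction j arbitrary: lo hi q)
  case 0
  then show ?case by simp
next
  case (Suc j)
  define m where "m = (lo + hi) div 2"
  have halves: "lo < m" "m < hi" "m - lo \<le> 2 ^ j" "hi - m \<le> 2 ^ j"
    using Suc.prems unfolding m_def by auto
  have "m < n"
    using halves(2) Suc.prems(3) by simp
  then have unfold_search: "binary_search mv lo hi q =
      (if m < x then binary_search mv m hi (q + 1)
       else if m = x then Some (m, q + 1) else binary_search mv lo m (q + 1))"
    by (subst binary_search.simps) (simp only: Let_def m_def[symmetric] points_to_case[OF assms(1)])
  consider "m = x" | "m < x" | "x < m" by linarith
  then show ?case
  proof cases
    assume "m = x"
    then show ?thesis
      by (auto simp: unfold_search)
  next
    assume "m < x"
    moreover from this obtain q' where
        "q' \<le> j" "binary_search mv m hi (q + 1) = Some (x, q + 1 + q')"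
      using Suc.IH[of m hi "q + 1"] halves Suc.prems by auto
    ultimately show ?thesis
      by (auto simp: unfold_search intro!: exI[of _ "Suc q'"])
  next
    assume "x < m"
    moreover from this obtain q' where
        "q' \<le> j" "binary_search mv lo m (q + 1) = Some (x, q + 1 + q')"
      using Suc.IH[of lo m "q + 1"] halves Suc.prems by auto
    ultimately show ?thesis
      by (auto simp: unfold_search intro!: exI[of _ "Suc q'"])
  qed
qed

text \<open>At most \<open>N - j + 1\<close> probes, then a binary search in an interval of length at most \<open>2 ^ N\<close>.\<close>

lemma doubling_search_queries:
  assumes "points_to mv n x" "a \<le> lo" "lo < x" "x \<le> a + 2 ^ N" "j \<le> N"
  shows "\<exists>q'\<le>2 * N + 1 - j. doubling_search mv n a (2 ^ j) lo q = Some (x, q + q')"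
  using assms(2-)
proof (induction "N - j" arbitrary: j lo q rule: less_induct)
  case less
  define m where "m = min (a + 2 ^ j) (n - 1)"
  have probe: "m < n" "m - lo \<le> 2 ^ j" "m < x \<Longrightarrow> m = a + 2 ^ j"
    using less.prems assms(1) unfolding m_def by (auto simp: points_to_def)
  then have unfold_search: "doubling_search mv n a (2 ^ j) lo q =
      (if m < x then doubling_search mv n a (2 ^ Suc j) m (q + 1)
       else if m = x then Some (m, q + 1) else binary_search mv lo m (q + 1))"
    by (subst doubling_search.simps)
      (simp only: Let_def m_def[symmetric] power_Suc points_to_case[OF assms(1)])
  consider "m = x" | "m < x" | "x < m" by linarith
  then show ?case
  proof cases
    assume "m = x"
    then show ?thesis
      using less.prems by (auto simp: unfold_search)
  next
    assume "m < x"
    then have "j < N"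
      using probe(3) less.prems by (cases "j = N") auto
    then have "N - Suc j < N - j"
      by simp
    then obtain q' where "q' \<le> 2 * N + 1 - Suc j"
        "doubling_search mv n a (2 ^ Suc j) m (q + 1) = Some (x, q + 1 + q')"
      using less.hyps[of "Suc j" m "q + 1"] \<open>m < x\<close> \<open>j < N\<close> probe(3) less.prems by auto
    then show ?thesis
      using \<open>m < x\<close> \<open>j < N\<close> less.prems by (auto simp: unfold_search intro!: exI[of _ "Suc q'"])
  next
    assume "x < m"
    moreover from this obtain q' where
        "q' \<le> j" "binary_search mv lo m (q + 1) = Some (x, q + 1 + q')"
      using binary_search_queries[OF assms(1), of lo m j "q + 1"] probe less.prems by auto
    ultimately show ?thesis
      using less.prems by (auto simp: unfold_search intro!: exI[of _ "Suc q'"])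
  qed
qed

lemma forward_search_queries:
  assumes "points_to (path_move ask p) (length p) x" "a < x" "x \<le> a + 2 ^ N"
  shows "\<exists>q'\<le>2 * N + 1. forward_search ask p a q = Some (p ! x, q + q')"
  using doubling_search_queries[OF assms(1), of a a N 0 q] assms(2,3)
  by (fastforce simp: forward_search_def)

lemma path_move_rev:
  assumes "distinct p" "i < length p"
  shows "path_move ask (rev p) i = (case path_move ask p (length p - 1 - i) of
    Backward \<Rightarrow> Forward | Stop \<Rightarrow> Stop | Forward \<Rightarrow> Backward)"
proof -
  define j where "j = length p - 1 - i"
  have reflect: "rev p ! k = p ! l" if "k + l + 1 = length p" for k l
    using that by (simp add: rev_nth flip: that)
  have current: "rev p ! i = p ! j"
    using assms(2) by (intro reflect) (auto simp: j_def)
  have successor: "rev p ! (i + 1) = p ! (j - 1)" if "0 < j"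
    using assms(2) that by (intro reflect) (auto simp: j_def)
  have predecessor: "rev p ! (i - 1) = p ! (j + 1)" if "j + 1 < length p"
    using assms(2) that by (intro reflect) (auto simp: j_def)
  have neighbours: "p ! (j + 1) \<noteq> p ! (j - 1)" if "j + 1 < length p"
    using assms(1) that by (simp add: nth_eq_iff_index_eq)
  have bounds: "i + 1 < length (rev p) \<longleftrightarrow> 0 < j" "0 < i \<longleftrightarrow> j + 1 < length p"
    using assms(2) by (auto simp: j_def)
  show ?thesis
    unfolding path_move_def j_def[symmetric] current bounds
    using successor predecessor neighbours
    by (cases "ask (p ! j)"; cases "0 < j"; cases "j + 1 < length p") (simp_all del: One_nat_def)
qed

lemma points_to_rev:
  assumes "distinct p" "points_to (path_move ask p) (length p) x"
  shows "points_to (path_move ask (rev p)) (length p) (length p - 1 - x)"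
  using assms(2) by (auto simp: points_to_def path_move_rev[OF assms(1)])

lemma exponential_search_queries:
  assumes "distinct p" and x: "points_to (path_move ask p) (length p) x"
    and a: "a < length p" "nat \<bar>int a - int x\<bar> \<le> 2 ^ N"
  shows "\<exists>q\<le>2 * N + 2. exponential_search ask p a = Some (p ! x, q)"
proof -
  note unfold_search = exponential_search_def points_to_case[OF x a(1)]
  consider "a = x" | "a < x" | "x < a" by linarith
  then show ?thesis
  proof cases
    assume "a = x"
    then show ?thesis
      unfolding unfold_search by simp
  next
    assume "a < x"
    moreover have "x \<le> a + 2 ^ N"
      using a(2) by linarith
    ultimately obtain q' where "q' \<le> 2 * N + 1" "forward_search ask p a 1 = Some (p ! x, 1 + q')"
      using forward_search_queries[OF x] by blast
    then show ?thesis
      using \<open>a < x\<close> by (simp add: unfold_search)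
  next
    assume "x < a"
    then have "length p - 1 - a < length p - 1 - x" "length p - 1 - x \<le> length p - 1 - a + 2 ^ N"
      using a by linarith+
    then obtain q' where "q' \<le> 2 * N + 1"
        "forward_search ask (rev p) (length p - 1 - a) 1 =
          Some (rev p ! (length p - 1 - x), 1 + q')"
      using forward_search_queries[of ask "rev p" "length p - 1 - x" "length p - 1 - a" N 1]
        points_to_rev[OF assms(1) x] by auto
    moreover have "rev p ! (length p - 1 - x) = p ! x"
      using x by (auto simp: rev_nth points_to_def)
    ultimately show ?thesis
      using \<open>x < a\<close> by (simp add: unfold_search)
  qed
qed

section \<open>Paths in graphs\<close>

lemma vpath_append_iff:
  assumes "p \<noteq> []" "q \<noteq> []"
  shows "vpath (p @ q) G \<longleftrightarrow>
    vpath p G \<and> vpath q G \<and> (last p, hd q) \<in> arcs_ends G \<and> set p \<inter> set q = {}"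
  using assms by (auto simp: vpath_def vwalk_def vwalk_arcs_append)

lemma vpath_infix: "vpath (p @ q @ r) G \<Longrightarrow> q \<noteq> [] \<Longrightarrow> vpath q G"
  by (cases "p = []"; cases "r = []") (auto simp: vpath_append_iff)

lemma (in sym_digraph) vpath_rev: "vpath p G \<Longrightarrow> vpath (rev p) G"
  using vwalk_rev_ex[OF sym_arcs] by (auto simp: vpath_def)

lemma (in wf_digraph) vwalk_imp_awalk:
  assumes "vwalk p G"
  shows "\<exists>es. awalk (hd p) es (last p) \<and> awalk_verts (hd p) es = p"
  using assms
proof (induction p rule: vwalk_induct)
  case (Base u)
  then show ?case by (auto intro!: exI[of _ "[]"] simp: awalk_Nil_iff)
next
  case (Cons u v ws)
  then obtain es e where "awalk v es (last (v # ws))" "awalk_verts v es = v # ws"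
      "e \<in> arcs G" "tail G e = u" "head G e = v"
    by (auto simp: arcs_ends_conv)
  then show ?case
    by (intro exI[of _ "e # es"]) (auto simp: awalk_Cons_iff)
qed

definition path_segment :: "'a list \<Rightarrow> nat \<Rightarrow> nat \<Rightarrow> 'a list" where
  "path_segment p i j = map ((!) p) (if i \<le> j then [i..<Suc j] else rev [j..<Suc i])"

lemma path_segment_self: "path_segment p i i = [p ! i]"
  by (simp add: path_segment_def)

lemma path_segment_not_Nil: "path_segment p i j \<noteq> []"
  by (simp add: path_segment_def)

lemma rev_path_segment: "rev (path_segment p i j) = path_segment p j i"
  by (cases i j rule: linorder_cases) (simp_all add: path_segment_def rev_map)

lemma length_path_segment: "length (path_segment p i j) = Suc (nat \<bar>int i - int j\<bar>)"
  by (simp add: path_segment_def) linarith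

lemma last_path_segment: "last (path_segment p i j) = p ! j"
  by (simp add: path_segment_def last_map last_rev hd_map hd_append del: upt_Suc)

lemma hd_path_segment: "hd (path_segment p i j) = p ! i"
  by (metis last_path_segment rev_path_segment hd_rev)

lemma set_path_segment_subset: "i < length p \<Longrightarrow> j < length p \<Longrightarrow> set (path_segment p i j) \<subseteq> set p"
  by (auto simp: path_segment_def)

lemma path_segment_nth_1:
  assumes "i \<noteq> j"
  shows "path_segment p i j ! 1 = p ! (if i < j then i + 1 else i - 1)"
  using assms by (auto simp: path_segment_def rev_nth nth_append simp del: upt_Suc)

lemma (in sym_digraph) vpath_segment:
  assumes "vpath p G" "i < length p" "j < length p"
  shows "vpath (path_segment p i j) G"
proof -
  have ascending: "vpath (path_segment p i j) G" if "i \<le> j" "j < length p" for i j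
  proof -
    have "path_segment p i j = take (Suc j - i) (drop i p)"
      using that by (intro nth_equalityI) (simp_all add: path_segment_def del: upt_Suc)
    then have "p = take i p @ path_segment p i j @ drop (Suc j - i) (drop i p)"
      by (metis append_take_drop_id)
    then show ?thesis
      using assms(1) path_segment_not_Nil vpath_infix by metis
  qed
  show ?thesis
  proof (cases "i \<le> j")
    case True
    then show ?thesis
      using ascending assms(3) by blast
  next
    case False
    then have "vpath (path_segment p j i) G"
      using ascending assms(2) by simp
    from vpath_rev[OF this] show ?thesis
      by (simp add: rev_path_segment)
  qed
qed

definition (in pre_digraph) entry_path :: "'a list \<Rightarrow> 'a \<Rightarrow> 'a list \<Rightarrow> nat \<Rightarrow> bool" where
  "entry_path p u r x \<longleftrightarrow> x < length p \<and> vpath (r @ [p ! x]) G \<and> hd (r @ [p ! x]) = u \<and>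
     set r \<inter> set p = {}"

lemma (in sym_digraph) vpath_entry_path_segment:
  assumes "vpath p G" "entry_path p u r x" "i < length p"
  shows "vpath (r @ path_segment p x i) G"
proof (cases "r = []")
  case True
  then show ?thesis
    using assms by (simp add: vpath_segment entry_path_def)
next
  case False
  have "set r \<inter> set (path_segment p x i) = {}"
    using assms(2,3) set_path_segment_subset[of x p i] by (auto simp: entry_path_def)
  then show ?thesis
    using assms False
    by (simp add: vpath_segment entry_path_def vpath_append_iff
        path_segment_not_Nil hd_path_segment)
qed

lemma (in pre_digraph) hd_entry_path_segment:
  assumes "entry_path p u r x"
  shows "hd (r @ path_segment p x i) = u"
  using assms by (auto simp: entry_path_def hd_append hd_path_segment split: if_splits)

lemma (in pre_digraph) entry_path_suffix:
  assumes "entry_path p u (r @ w # r') x"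
  shows "entry_path p w (w # r') x"
  using assms vpath_infix[of r "w # r' @ [p ! x]" "[]" G]
  by (simp add: entry_path_def Int_Un_distrib2)

lemma (in pre_digraph) entry_path_start_in_set:
  assumes "entry_path p u r x" "r \<noteq> []"
  shows "u \<in> set r"
  using assms by (cases r) (simp_all add: entry_path_def)

lemma (in pre_digraph) entry_path_start_on_path:
  assumes "entry_path p u r x" "u \<in> set p"
  shows "r = []" "u = p ! x"
proof -
  show "r = []"
    using assms entry_path_start_in_set[OF assms(1)] by (auto simp: entry_path_def)
  then show "u = p ! x"
    using assms(1) by (simp add: entry_path_def)
qed

section \<open>Forests\<close>

locale undirected_forest = graph +
  assumes cycle_short: "cycle c \<Longrightarrow> length c < 3"
begin

lemma vpath_ends_nonadjacent:
  assumes "vpath p G" "3 \<le> length p"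
  shows "(last p, hd p) \<notin> arcs_ends G"
proof
  assume "(last p, hd p) \<in> arcs_ends G"
  then obtain e where e: "e \<in> arcs G" "tail G e = last p" "head G e = hd p"
    by (auto simp: arcs_ends_conv)
  obtain es where es: "awalk (hd p) es (last p)" "awalk_verts (hd p) es = p"
    using vwalk_imp_awalk assms(1) by blast
  have closed: "awalk (hd p) (es @ [e]) (hd p)"
    using es e assms by (auto simp: awalk_Cons_iff awalk_Nil_iff)
  moreover have "awalk_verts (hd p) (es @ [e]) = p @ [hd p]"
    using awalk_verts_append[OF closed] es e by simp
  moreover have "distinct (tl (p @ [hd p]))"
    using assms by (cases p) auto
  ultimately have "cycle (es @ [e])"
    unfolding cycle_def by auto
  moreover have "length p = Suc (length es)"
    using es(2) by (metis length_awalk_verts)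
  ultimately show False
    using cycle_short assms(2) by fastforce
qed

lemma vpaths_meeting_again_hd_eq:
  assumes p: "vpath (u # p) G" and q: "vpath (u # q) G" and "set p \<inter> set q \<noteq> {}"
  shows "hd p = hd q"
proof (rule ccontr)
  assume heads: "hd p \<noteq> hd q"
  have "\<exists>w \<in> set p. w \<in> set q"
    using assms(3) by blast
  then obtain p1 w p2 where p_split: "p = p1 @ w # p2" "w \<in> set q" "\<forall>v\<in>set p1. v \<notin> set q"
    by (auto elim!: split_list_first_propE)
  obtain q1 q2 where q_split: "q = q1 @ w # q2"
    using p_split(2) by (meson split_list)
  define c where "c = rev (u # q1 @ [w]) @ p1"
  have p1: "vpath (u # p1) G" "(last (u # p1), w) \<in> arcs_ends G"
    using p vpath_append_iff[of "u # p1" "w # p2" G] by (simp_all add: p_split(1))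
  have "vpath (u # q1 @ [w]) G"
    using q vpath_append_iff[of "u # q1 @ [w]" q2 G] by (cases "q2 = []") (simp_all add: q_split)
  then have "vpath (rev (u # q1 @ [w])) G"
    by (rule vpath_rev)
  moreover have "set (u # q1 @ [w]) \<inter> set p1 = {}"
    using p p_split(1,3) by (auto simp: q_split vpath_def)
  ultimately have "vpath c G"
    using p1(1) vpath_append_iff[of "[u]" p1 G] vpath_append_iff[of "rev (u # q1 @ [w])" p1 G]
    by (cases "p1 = []") (auto simp: c_def)
  moreover have "3 \<le> length c"
    using heads unfolding c_def p_split(1) q_split by (cases p1; cases q1) auto
  moreover have "(last c, hd c) \<in> arcs_ends G"
    using p1(2) by (auto simp: c_def)
  ultimately show False
    using vpath_ends_nonadjacent by blast
qed

lemma vpath_unique: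
  assumes "vpath p G" "vpath q G" "hd p = hd q" "last p = last q"
  shows "p = q"
  using assms
proof (induction p arbitrary: q)
  case Nil
  then show ?case by (simp add: vpath_def vwalk_def)
next
  case (Cons u p)
  obtain q1 where q: "q = u # q1"
    using Cons.prems by (cases q) (auto simp: vpath_def vwalk_def)
  show ?case
  proof (cases "p = [] \<or> q1 = []")
    case True
    then show ?thesis
      using Cons.prems q by (auto simp: vpath_def split: if_splits)
  next
    case False
    then have lasts: "last p = last q1"
      using Cons.prems(4) by (simp add: q)
    then have "last p \<in> set p \<inter> set q1"
      using False by (metis IntI last_in_set)
    then have "hd p = hd q1"
      using vpaths_meeting_again_hd_eq Cons.prems(1,2) unfolding q by blast
    moreover have "vpath p G" "vpath q1 G"
      using Cons.prems(1,2) False vpath_infix[of "[u]" p "[]" G] vpath_infix[of "[u]" q1 "[]" G]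
      by (simp_all add: q)
    ultimately show ?thesis
      using Cons.IH[of q1] lasts by (simp add: q)
  qed
qed

lemma tree_path_eq:
  assumes "vpath p G" "hd p = u" "last p = v"
  shows "tree_path G u v = p"
  unfolding tree_path_def using assms vpath_unique by (intro the_equality) auto

lemma tree_dist_eq:
  assumes "vpath p G" "hd p = u" "last p = v"
  shows "tree_dist G u v = length p - 1"
  using tree_path_eq[OF assms] by (simp add: tree_dist_def)

lemma tree_path_to_position:
  assumes "vpath p G" "entry_path p u r x" "i < length p"
  shows "tree_path G u (p ! i) = r @ path_segment p x i"
  using vpath_entry_path_segment[OF assms] hd_entry_path_segment[OF assms(2)]
  by (intro tree_path_eq) (simp_all add: path_segment_not_Nil last_path_segment)

lemma tree_path_from_position:
  assumes "vpath p G" "entry_path p u r x" "i < length p"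
  shows "tree_path G (p ! i) u = path_segment p i x @ rev r"
  using vpath_rev[OF vpath_entry_path_segment[OF assms]] hd_entry_path_segment[OF assms(2)]
  by (intro tree_path_eq) (auto simp: rev_path_segment path_segment_not_Nil hd_path_segment
      last_path_segment last_append last_rev)

lemma entry_position_unique:
  assumes "vpath p G" "entry_path p u r x" "entry_path p u r' y"
  shows "x = y"
proof -
  have y: "y < length p"
    using assms(3) by (simp add: entry_path_def)
  have "p ! x \<in> set (r @ path_segment p x y)"
    using hd_in_set[OF path_segment_not_Nil, of p x y] by (simp add: hd_path_segment)
  also have "r @ path_segment p x y = r' @ [p ! y]"
    using tree_path_to_position[OF assms(1,2) y] tree_path_to_position[OF assms(1,3) y]
    by (simp add: path_segment_self)
  finally have "p ! x = p ! y"
    using assms(2,3) nth_mem[of x p] by (auto simp: entry_path_def)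
  then show ?thesis
    using assms by (simp add: entry_path_def vpath_def nth_eq_iff_index_eq)
qed

lemma entry_paths_disjoint:
  assumes "vpath p G" "entry_path p u r x" "entry_path p v r' y" "x \<noteq> y"
  shows "set r \<inter> set r' = {}"
proof (rule ccontr)
  assume "set r \<inter> set r' \<noteq> {}"
  then obtain w r1 r2 r1' r2' where split: "r = r1 @ w # r2" "r' = r1' @ w # r2'"
    by (metis Int_emptyI split_list)
  have "entry_path p w (w # r2) x"
    using assms(2) unfolding split by (rule entry_path_suffix)
  moreover have "entry_path p w (w # r2') y"
    using assms(3) unfolding split by (rule entry_path_suffix)
  ultimately show False
    using entry_position_unique assms(1,4) by blast
qed

lemma tree_dist_to_position:
  assumes "vpath p G" "entry_path p u r x" "i < length p"
  shows "tree_dist G u (p ! i) = length r + nat \<bar>int x - int i\<bar>"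
  by (simp add: tree_dist_def tree_path_to_position[OF assms] length_path_segment)

lemma tree_dist_disjoint_entry_paths:
  assumes p: "vpath p G" and s: "entry_path p s r' a" and t: "entry_path p t r x"
    and disj: "set r \<inter> set r' = {}"
  shows "tree_dist G s t = length r' + nat \<bar>int a - int x\<bar> + length r"
proof -
  have positions: "a < length p" "x < length p"
    using s t by (simp_all add: entry_path_def)
  have to_x: "vpath (r' @ path_segment p a x) G"
    using vpath_entry_path_segment[OF p s positions(2)] .
  have from_a: "vpath (path_segment p a x @ rev r) G"
    using vpath_rev[OF vpath_entry_path_segment[OF p t positions(1)]]
    by (simp add: rev_path_segment)
  have "vpath ((r' @ path_segment p a x) @ rev r) G"
  proof (cases "r = []")
    case True
    then show ?thesis
      using to_x by simp
  next
    case False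
    then show ?thesis
      using to_x from_a disj
      by (subst vpath_append_iff) (auto simp: vpath_append_iff path_segment_not_Nil)
  qed
  then have "tree_dist G s t = length ((r' @ path_segment p a x) @ rev r) - 1"
    using hd_entry_path_segment[OF s] t
    by (intro tree_dist_eq)
      (auto simp: entry_path_def path_segment_not_Nil last_path_segment last_rev hd_append)
  then show ?thesis
    by (simp add: length_path_segment)
qed

lemma entry_distance_le_tree_dist:
  assumes "vpath p G" "entry_path p s r' a" "entry_path p t r x"
  shows "nat \<bar>int a - int x\<bar> \<le> tree_dist G s t"
proof (cases "a = x")
  case False
  then have "set r \<inter> set r' = {}"
    using entry_paths_disjoint[OF assms(1,3,2)] by simp
  then show ?thesis
    using tree_dist_disjoint_entry_paths[OF assms] by simp
qed simp

lemma closest_position_entry_path: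
  assumes "vpath p G" "entry_path p s r a"
  shows "closest_position G p s = a"
proof -
  let ?f = "\<lambda>i. tree_dist G s (p ! i)"
  let ?b = "closest_position G p s"
  have a: "a < length p"
    using assms(2) by (simp add: entry_path_def)
  have "?b < length p"
    using arg_min_if_finite(1)[of "{..<length p}" ?f] a by (auto simp: closest_position_def)
  moreover have "?f ?b \<le> ?f a"
    unfolding closest_position_def using a by (intro arg_min_least) auto
  ultimately show ?thesis
    by (simp add: tree_dist_to_position[OF assms] a)
qed

lemma direction_oracle_entry_position:
  assumes "vpath p G" "entry_path p t r x"
  shows "direction_oracle G t (p ! x) = (if r = [] then Here else Toward (last r))"
proof -
  have "x < length p"
    using assms(2) by (simp add: entry_path_def)
  then have "tree_path G (p ! x) t = p ! x # rev r"
    using tree_path_from_position[OF assms] by (simp add: path_segment_self)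
  moreover have "p ! x = t \<longleftrightarrow> r = []"
    using entry_path_start_on_path(1)[OF assms(2)] nth_mem[OF \<open>x < length p\<close>] assms(2)
    by (auto simp: entry_path_def)
  ultimately show ?thesis
    by (auto simp: direction_oracle_def last_conv_nth rev_nth)
qed

lemma direction_oracle_off_entry_position:
  assumes "vpath p G" "entry_path p t r x" "i < length p" "i \<noteq> x"
  shows "direction_oracle G t (p ! i) = Toward (p ! (if i < x then i + 1 else i - 1))"
proof -
  have "p ! i \<noteq> p ! x"
    using assms by (simp add: entry_path_def vpath_def nth_eq_iff_index_eq)
  then have "p ! i \<noteq> t"
    using entry_path_start_on_path(2)[OF assms(2)] nth_mem[OF assms(3)] by metis
  moreover have "tree_path G (p ! i) t ! 1 = path_segment p i x ! 1"
    using assms(4)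
    by (simp add: tree_path_from_position[OF assms(1-3)] nth_append length_path_segment)
  ultimately show ?thesis
    by (simp add: direction_oracle_def path_segment_nth_1[OF assms(4)] del: One_nat_def)
qed

lemma path_move_points_to:
  assumes p: "vpath p G" and t: "entry_path p t r x"
  shows "points_to (path_move (direction_oracle G t) p) (length p) x"
  unfolding points_to_def
proof (intro conjI allI impI)
  show x: "x < length p"
    using t by (simp add: entry_path_def)
  fix i
  assume i: "i < length p"
  show "path_move (direction_oracle G t) p i =
    (if i < x then Forward else if i = x then Stop else Backward)"
  proof (cases "i = x")
    case True
    have "last r \<notin> set p" if "r \<noteq> []"
      using t last_in_set[OF that] by (auto simp: entry_path_def)
    then show ?thesis
      using True i direction_oracle_entry_position[OF p t]
      by (cases "r = []") (auto simp: path_move_def)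
  next
    case False
    have "p ! (i - 1) \<noteq> p ! (i + 1)" if "i + 1 < length p"
      using p that by (auto simp: vpath_def nth_eq_iff_index_eq)
    then show ?thesis
      using False i x direction_oracle_off_entry_position[OF p t i False]
      by (auto simp: path_move_def)
  qed
qed

lemma exponential_search_from_closest_position:
  assumes p: "vpath p G" and s: "entry_path p s r' a" and t: "entry_path p t r x"
    and "tree_dist G s t \<le> 2 ^ N"
  shows "\<exists>q\<le>2 * N + 2.
    exponential_search (direction_oracle G t) p (closest_position G p s) = Some (p ! x, q)"
proof -
  have "nat \<bar>int a - int x\<bar> \<le> 2 ^ N"
    using entry_distance_le_tree_dist[OF p s t] assms(4) by linarith
  moreover have "a < length p"
    using s by (simp add: entry_path_def)
  moreover have "distinct p"
    using p by auto
  ultimately show ?thesis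
    using exponential_search_queries path_move_points_to[OF p t] closest_position_entry_path[OF p s]
    by metis
qed

end

section \<open>Components\<close>

lemma induce_induce_subgraph: "C \<subseteq> S \<Longrightarrow> (G \<restriction> S) \<restriction> C = G \<restriction> C"
  by (auto simp: induce_subgraph_def)

lemma (in wf_digraph) induce_subgraph_verts_self: "G \<restriction> verts G = G"
  by (rule pre_digraph.equality) auto

lemma (in wf_digraph) vwalk_induce_iff:
  assumes "S \<subseteq> verts G"
  shows "vwalk p (G \<restriction> S) \<longleftrightarrow> vwalk p G \<and> set p \<subseteq> S"
proof -
  have "arcs_ends (G \<restriction> S) = arcs_ends G \<inter> S \<times> S"
    by (auto simp: arcs_ends_conv)
  then show ?thesis
    using assms arcs_in_vwalk_arcs[of _ p] by (fastforce simp: vwalk_def)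
qed

lemma (in wf_digraph) vpath_induce_iff:
  assumes "S \<subseteq> verts G"
  shows "vpath p (G \<restriction> S) \<longleftrightarrow> vpath p G \<and> set p \<subseteq> S"
  using vwalk_induce_iff[OF assms] by (auto simp: vpath_def)

lemma (in wf_digraph) components_subset: "C \<in> components (G \<restriction> S) \<Longrightarrow> C \<subseteq> S"
  using wf_digraph.sccs_verts_subsets[OF wellformed_induce_subgraph] by fastforce

lemma (in wf_digraph) strongly_connected_component:
  assumes "C \<in> components (G \<restriction> S)"
  shows "strongly_connected (G \<restriction> C)"
proof -
  have "max_reachable_set (G \<restriction> S) C"
    using assms wellformed_induce_subgraph
    by (auto simp: max_reachable_set_def max_reachable_set_axioms_def)
  from max_reachable_set.strongly_connected[OF this] show ?thesis
    by (simp add: induce_induce_subgraph[OF components_subset[OF assms]])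
qed

lemma (in sym_digraph) vwalk_in_component_of:
  assumes "S \<subseteq> verts G" "vwalk p G" "set p \<subseteq> S" "u \<in> set p" "v \<in> set p"
  shows "u \<in> component_of (G \<restriction> S) v"
proof -
  interpret S: sym_digraph "G \<restriction> S"
    using induced_graph_imp_graph induced_induce assms(1) by blast
  have to_last: "w \<in> S.scc_of (last p)" if w: "w \<in> set p" for w
  proof -
    obtain p1 p2 where p: "p = p1 @ w # p2"
      using w by (meson split_list)
    then have "vwalk (w # p2) (G \<restriction> S)"
      using assms(2,3) vwalkI_append_r[of "w # p2" p1 G]
      by (auto simp: vwalk_induce_iff[OF assms(1)])
    then have "w \<rightarrow>\<^sup>*\<^bsub>G \<restriction> S\<^esub> last p"
      unfolding S.reachable_vwalk_conv by (intro exI[of _ "w # p2"]) (simp add: p)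
    then show ?thesis
      by (rule S.scc_ofI_reachable)
  qed
  show ?thesis
    using to_last[OF assms(4)] S.scc_of_eq[OF to_last[OF assms(5)]] by simp
qed

lemma (in wf_digraph) exists_entry_path:
  assumes "C \<subseteq> verts G" "strongly_connected (G \<restriction> C)" "set p \<subseteq> C" "p \<noteq> []" "u \<in> C"
  obtains r x where "entry_path p u r x" "set r \<subseteq> C"
proof -
  have "u \<rightarrow>\<^sup>*\<^bsub>G \<restriction> C\<^esub> hd p"
    using assms(2,3,5) hd_in_set[OF assms(4)] by (auto simp: strongly_connected_def)
  then obtain w where w: "vpath w G" "set w \<subseteq> C" "hd w = u" "last w = hd p"
    using wf_digraph.reachable_vpath_conv[OF wellformed_induce_subgraph]
      vpath_induce_iff[OF assms(1)] by blast
  then have "\<exists>v \<in> set w. v \<in> set p"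
    using assms(4) by (metis hd_in_set last_in_set vpathE vwalkE)
  then obtain r z w' where split: "w = r @ z # w'" "z \<in> set p" "\<forall>v\<in>set r. v \<notin> set p"
    by (auto elim!: split_list_first_propE)
  obtain x where x: "x < length p" "z = p ! x"
    using split(2) by (metis in_set_conv_nth)
  have "vpath (r @ [z]) G"
    using w(1) vpath_append_iff[of "r @ [z]" w' G] by (cases "w' = []") (auto simp: split(1))
  then have "entry_path p u r x"
    using x split w(3) by (auto simp: entry_path_def hd_append)
  then show thesis
    using that w(2) by (auto simp: split(1))
qed

lemma (in sym_digraph) entry_path_in_component_of:
  assumes "C \<subseteq> verts G" "entry_path p u r x" "set r \<subseteq> C" "v \<in> set r" "w \<in> set r"
  shows "v \<in> component_of (G \<restriction> (C - set p)) w"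
proof (rule vwalk_in_component_of[where p = r])
  show "vwalk r G"
    using assms(2,4) vpath_append_iff[of r "[p ! x]" G] by (fastforce simp: entry_path_def)
qed (use assms in \<open>auto simp: entry_path_def\<close>)

lemma (in sym_digraph) entry_path_component:
  assumes "C \<subseteq> verts G" "entry_path p u r x" "set r \<subseteq> C" "r \<noteq> []"
  shows "component_of (G \<restriction> (C - set p)) (last r) \<in> components (G \<restriction> (C - set p))"
    and "set r \<subseteq> component_of (G \<restriction> (C - set p)) (last r)"
proof -
  have "last r \<in> C - set p"
    using assms(2,3) last_in_set[OF assms(4)] by (auto simp: entry_path_def)
  then show "component_of (G \<restriction> (C - set p)) (last r) \<in> components (G \<restriction> (C - set p))"
    by (intro wf_digraph.scc_of_in_sccs_verts) auto
  show "set r \<subseteq> component_of (G \<restriction> (C - set p)) (last r)"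
    using entry_path_in_component_of[OF assms(1-3)] last_in_set[OF assms(4)] by blast
qed

lemma (in sym_digraph) entry_paths_meeting_in_component_of:
  assumes C: "C \<subseteq> verts G"
    and s: "entry_path p s r' a" "set r' \<subseteq> C"
    and t: "entry_path p t r x" "set r \<subseteq> C"
    and "set r \<inter> set r' \<noteq> {}" "v \<in> set r"
  shows "s \<in> component_of (G \<restriction> (C - set p)) v"
proof -
  interpret off_spine: wf_digraph "G \<restriction> (C - set p)" ..
  obtain w where w: "w \<in> set r" "w \<in> set r'"
    using assms(6) by blast
  have "s \<in> set r'"
    using w(2) by (intro entry_path_start_in_set[OF s(1)]) auto
  then have "s \<in> off_spine.scc_of w"
    using entry_path_in_component_of[OF C s] w(2) by blast
  also have "\<dots> = off_spine.scc_of v"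
    using entry_path_in_component_of[OF C t w(1) assms(7)] by (rule off_spine.scc_of_eq)
  finally show ?thesis .
qed

lemma (in undirected_forest) tree_dist_next_start_le:
  assumes C: "C \<subseteq> verts G" and p: "vpath p G"
    and s: "entry_path p s r' a" "set r' \<subseteq> C"
    and t: "entry_path p t r x" "set r \<subseteq> C" "r \<noteq> []"
    and "s \<notin> component_of (G \<restriction> (C - set p)) (last r)"
  shows "tree_dist G (last r) t \<le> tree_dist G s t"
proof -
  have "vpath (rev r) G" "hd r = t"
    using t(1,3) vpath_append_iff[of r "[p ! x]" G] by (auto intro!: vpath_rev simp: entry_path_def)
  then have "tree_dist G (last r) t = length r - 1"
    using tree_dist_eq[of "rev r"] t(3) by (simp add: hd_rev last_rev)
  moreover have "set r \<inter> set r' = {}"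
    using entry_paths_meeting_in_component_of[OF C s t(1,2), of "last r"] t(3) assms(8) by auto
  ultimately show ?thesis
    using tree_dist_disjoint_entry_paths[OF p s(1) t(1)] by simp
qed

section \<open>Pathwidth\<close>

lemma (in wf_digraph) pathwidth_attained:
  obtains Bs where "path_decomposition G Bs" "decomposition_width Bs = pathwidth G"
proof -
  have "path_decomposition G [verts G]"
    by (auto simp: path_decomposition_def dest: adj_in_verts)
  then have "\<exists>w Bs. path_decomposition G Bs \<and> decomposition_width Bs = w"
    by blast
  from LeastI_ex[OF this] show thesis
    using that unfolding pathwidth_def by blast
qed

lemma card_bag_le:
  assumes "B \<in> set Bs"
  shows "card B \<le> Suc (decomposition_width Bs)"
proof -
  have "card B \<le> Max (card ` set Bs)"
    using assms by (intro Max_ge) auto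
  then show ?thesis
    by (simp add: decomposition_width_def)
qed

lemma (in fin_digraph) pathwidth_pos:
  assumes "(u, v) \<in> arcs_ends G" "u \<noteq> v"
  shows "0 < pathwidth G"
proof -
  obtain Bs where Bs: "path_decomposition G Bs" "decomposition_width Bs = pathwidth G"
    by (rule pathwidth_attained)
  obtain B where B: "B \<in> set Bs" "u \<in> B" "v \<in> B"
    using Bs(1) assms(1) unfolding path_decomposition_def by blast
  have "B \<subseteq> verts G"
    using Bs(1) B(1) by (auto simp: path_decomposition_def)
  then have "card {u, v} \<le> card B"
    using B by (intro card_mono) (auto intro: finite_subset)
  also have "\<dots> \<le> Suc (pathwidth G)"
    using card_bag_le[OF B(1)] Bs(2) by simp
  finally show ?thesis
    using assms(2) by simp
qed

lemma (in fin_digraph) pathwidth_0_imp_singleton: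
  assumes "strongly_connected G" "pathwidth G = 0"
  shows "is_singleton (verts G)"
proof -
  have "u = v" if "u \<rightarrow>\<^sup>* v" for u v
    using that
  proof (induction rule: reachable_induct)
    case (step v w)
    then show ?case
      using pathwidth_pos assms(2) by fastforce
  qed simp
  then show ?thesis
    using assms(1) by (auto simp: strongly_connected_def intro!: is_singletonI')
qed

section \<open>Spine exponential search\<close>

lemma (in wf_digraph) arising_component:
  assumes "strongly_connected G" "C \<in> arising_components G \<sigma>"
  shows "C \<subseteq> verts G" "strongly_connected (G \<restriction> C)"
  using assms(2)
proof induction
  case whole
  show "verts G \<subseteq> verts G" "strongly_connected (G \<restriction> verts G)"
    using assms(1) by (simp_all add: induce_subgraph_verts_self)
next
  case (part C C')
  show "C' \<subseteq> verts G"
    using part components_subset by blast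
  show "strongly_connected (G \<restriction> C')"
    using part strongly_connected_component by blast
qed

lemma (in wf_digraph) designated_spine:
  assumes "strongly_connected G" "spine_decomposition G \<sigma>"
    and "C \<in> arising_components G \<sigma>" "\<not> is_singleton C"
  shows "vpath (\<sigma> C) G" "set (\<sigma> C) \<subseteq> C" "\<sigma> C \<noteq> []"
proof -
  have "vpath (\<sigma> C) (G \<restriction> C)"
    using assms(2-4) by (simp add: spine_decomposition_def is_spine_def)
  then show "vpath (\<sigma> C) G" "set (\<sigma> C) \<subseteq> C" "\<sigma> C \<noteq> []"
    using vpath_induce_iff[OF arising_component(1)[OF assms(1,3)]]
    by (auto simp: vpath_def vwalk_def)
qed

lemma spine_search_from_step:
  assumes "\<not> is_singleton C"
    and "exponential_search ask (\<sigma> C) (closest_position T (\<sigma> C) s) = Some (x, n)"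
  shows "spine_search_from T ask \<sigma> C s q =
    (case ask x of
       Here \<Rightarrow> Some (x, q + n)
     | Toward y \<Rightarrow>
         (let C' = component_of (T \<restriction> (C - set (\<sigma> C))) y in
          spine_search_from T ask \<sigma> C' (if s \<in> C' then s else y) (q + n)))"
  using assms by (subst spine_search_from.simps) simp

lemma spine_search_from_singleton:
  assumes "is_singleton C" "t \<in> C"
  shows "spine_search_from T ask \<sigma> C s q = Some (t, q)"
  using assms by (subst spine_search_from.simps) (auto simp: is_singleton_def)

lemma (in wf_digraph) pathwidth_next_component_le:
  assumes "spine_decomposition G \<sigma>" "C \<in> arising_components G \<sigma>" "\<not> is_singleton C"
    and C': "C' \<in> components (G \<restriction> (C - set (\<sigma> C)))"
  shows "pathwidth (G \<restriction> C') \<le> pathwidth (G \<restriction> C) - 1"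
proof -
  have "(G \<restriction> C) \<restriction> (C - set (\<sigma> C)) = G \<restriction> (C - set (\<sigma> C))" "(G \<restriction> C) \<restriction> C' = G \<restriction> C'"
    using components_subset[OF C'] by (auto intro!: induce_induce_subgraph)
  moreover have "is_spine (G \<restriction> C) (pathwidth (G \<restriction> C)) (\<sigma> C)"
    using assms(1-3) by (simp add: spine_decomposition_def)
  ultimately show ?thesis
    using C' by (metis is_spine_def induce_subgraph_verts)
qed

context undirected_forest
begin

lemma spine_search_round:
  assumes G: "strongly_connected G" and \<sigma>: "spine_decomposition G \<sigma>"
    and C: "C \<in> arising_components G \<sigma>" "\<not> is_singleton C"
    and "s \<in> C" "t \<in> C" "tree_dist G s t \<le> 2 ^ N"
  defines "search \<equiv> spine_search_from G (direction_oracle G t) \<sigma>"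
  obtains
    (found) n where "n \<le> 2 * N + 2" "\<And>q. search C s q = Some (t, q + n)"
  | (descend) n C' s' where "n \<le> 2 * N + 2" "\<And>q. search C s q = search C' s' (q + n)"
      "C' \<in> components (G \<restriction> (C - set (\<sigma> C)))" "s' \<in> C'" "t \<in> C'"
      "tree_dist G s' t \<le> tree_dist G s t"
proof -
  note C_connected = arising_component[OF G C(1)] and p = designated_spine[OF G \<sigma> C]
  obtain r' a where s: "entry_path (\<sigma> C) s r' a" "set r' \<subseteq> C"
    using exists_entry_path[OF C_connected p(2,3) assms(5)] .
  obtain r x where t: "entry_path (\<sigma> C) t r x" "set r \<subseteq> C"
    using exists_entry_path[OF C_connected p(2,3) assms(6)] .
  obtain n where n: "n \<le> 2 * N + 2" "exponential_search (direction_oracle G t) (\<sigma> C)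
      (closest_position G (\<sigma> C) s) = Some (\<sigma> C ! x, n)"
    using exponential_search_from_closest_position[OF p(1) s(1) t(1) assms(7)] by blast
  note unfold_search = spine_search_from_step[where T = G and \<sigma> = \<sigma>, OF C(2) n(2)]
  show thesis
  proof (cases "r = []")
    case True
    then have "\<sigma> C ! x = t"
      using t(1) by (simp add: entry_path_def)
    then have "search C s q = Some (t, q + n)" for q
      by (simp add: search_def unfold_search direction_oracle_def)
    with n(1) show thesis by (rule found)
  next
    case False
    define C' where "C' = component_of (G \<restriction> (C - set (\<sigma> C))) (last r)"
    define s' where "s' = (if s \<in> C' then s else last r)"
    have C': "C' \<in> components (G \<restriction> (C - set (\<sigma> C)))" "set r \<subseteq> C'"
      using entry_path_component[OF C_connected(1) t False] by (simp_all add: C'_def)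
    then have "s' \<in> C'" "t \<in> C'"
      using False entry_path_start_in_set[OF t(1)] by (auto simp: s'_def)
    moreover have "tree_dist G s' t \<le> tree_dist G s t"
      using tree_dist_next_start_le[OF C_connected(1) p(1) s t False] by (simp add: s'_def C'_def)
    moreover have "direction_oracle G t (\<sigma> C ! x) = Toward (last r)"
      using direction_oracle_entry_position[OF p(1) t(1)] False by simp
    then have "search C s q = search C' s' (q + n)" for q
      by (simp add: search_def unfold_search C'_def s'_def Let_def)
    ultimately show thesis
      using descend[of n C' s'] n(1) C'(1) by blast
  qed
qed

lemma spine_search_from_queries:
  assumes "strongly_connected G" "spine_decomposition G \<sigma>"
    and "C \<in> arising_components G \<sigma>" "s \<in> C" "t \<in> C"
    and "pathwidth (G \<restriction> C) \<le> k" "tree_dist G s t \<le> 2 ^ N"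
  shows "\<exists>n\<le>k * (2 * N + 2). spine_search_from G (direction_oracle G t) \<sigma> C s q = Some (t, q + n)"
  using assms(3-)
proof (induction k arbitrary: C s q)
  case 0
  note C = arising_component[OF assms(1) "0.prems"(1)]
  have "fin_digraph (G \<restriction> C)"
    using fin_digraph_subgraph subgraph_induce_subgraphI[OF C(1)] by blast
  then have "is_singleton C"
    using fin_digraph.pathwidth_0_imp_singleton[of "G \<restriction> C"] C(2) "0.prems"(4) by simp
  then show ?case
    using "0.prems"(3) by (simp add: spine_search_from_singleton)
next
  case (Suc k)
  show ?case
  proof (cases "is_singleton C")
    case True
    then show ?thesis
      using Suc.prems(3) by (simp add: spine_search_from_singleton)
  next
    case False
    from assms(1,2) Suc.prems(1) False Suc.prems(2,3,5) show ?thesis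
    proof (cases rule: spine_search_round)
      case (found n)
      then show ?thesis
        by (auto intro!: exI[of _ n])
    next
      case (descend n C' s')
      have "C' \<in> arising_components G \<sigma>"
        using arising_components.part[OF Suc.prems(1) False descend(3)] .
      moreover have "pathwidth (G \<restriction> C') \<le> k"
        using pathwidth_next_component_le[OF assms(2) Suc.prems(1) False descend(3)] Suc.prems(4)
        by linarith
      moreover have "tree_dist G s' t \<le> 2 ^ N"
        using descend(6) Suc.prems(5) by linarith
      ultimately obtain n' where "n' \<le> k * (2 * N + 2)"
          "spine_search_from G (direction_oracle G t) \<sigma> C' s' (q + n) = Some (t, q + n + n')"
        using Suc.IH[OF _ descend(4,5)] by blast
      then show ?thesis
        using descend(1,2) by (intro exI[of _ "n + n'"]) simp
    qed
  qed
qed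

lemma spine_exponential_search_queries:
  assumes "Digraph_Component.connected G" "spine_decomposition G \<sigma>" "s \<in> verts G" "t \<in> verts G"
  shows "\<exists>n \<le> pathwidth G * (2 * ceillog2 (tree_dist G s t) + 2).
    spine_exponential_search G \<sigma> s t = Some (t, n)"
proof -
  have "strongly_connected G"
    using symmetric_connected_imp_strongly_connected[OF sym_arcs assms(1)] .
  from spine_search_from_queries[OF this assms(2) arising_components.whole assms(3,4)
      _ le_two_power_ceillog2, of "pathwidth G" 0]
  show ?thesis
    by (simp add: spine_exponential_search_def induce_subgraph_verts_self)
qed

end

lemma undirected_tree_imp_forest: "undirected_tree T \<Longrightarrow> undirected_forest T"
  by (force simp: undirected_tree_def undirected_forest_def undirected_forest_axioms_def)

lemma ceillog2_le_max_log: "real (ceillog2 n) \<le> 2 * max 1 (log 2 (real n))"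
proof (cases "n = 0")
  case False
  then have "real (ceillog2 n) < log 2 (real n) + 1"
    by (simp add: ceillog2_less_log)
  then show ?thesis
    by linarith
qed simp

theorem theorem4:
  shows "\<exists>c :: real. c > 0 \<and>
    (\<forall>(T :: ('a, 'b) pre_digraph) \<sigma> s t.
       undirected_tree T \<and> spine_decomposition T \<sigma> \<and> s \<in> verts T \<and> t \<in> verts T \<longrightarrow>
       (\<exists>v q. spine_exponential_search T \<sigma> s t = Some (v, q) \<and>
          real q \<le> c * real (pathwidth T) * max 1 (log 2 (real (tree_dist T s t)))))"
proof (intro exI[of _ 6] conjI allI impI)
  fix T :: "('a, 'b) pre_digraph" and \<sigma> s t
  assume tree: "undirected_tree T \<and> spine_decomposition T \<sigma> \<and> s \<in> verts T \<and> t \<in> verts T"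
  then interpret undirected_forest T
    by (simp add: undirected_tree_imp_forest)
  let ?D = "tree_dist T s t"
  obtain n where n: "spine_exponential_search T \<sigma> s t = Some (t, n)"
      "n \<le> pathwidth T * (2 * ceillog2 ?D + 2)"
    using spine_exponential_search_queries tree unfolding undirected_tree_def by blast
  have "real n \<le> real (pathwidth T * (2 * ceillog2 ?D + 2))"
    using n(2) by (simp only: of_nat_le_iff)
  also have "\<dots> = real (pathwidth T) * (2 * real (ceillog2 ?D) + 2)"
    by (simp add: algebra_simps)
  also have "\<dots> \<le> real (pathwidth T) * (6 * max 1 (log 2 (real ?D)))"
    using ceillog2_le_max_log[of ?D] by (intro mult_left_mono) auto
  finally show "\<exists>v q. spine_exponential_search T \<sigma> s t = Some (v, q) \<and>
      real q \<le> 6 * real (pathwidth T) * max 1 (log 2 (real ?D))"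
    using n(1) by (simp add: mult_ac)
qed simp

end
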